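(* Let $B^{(n)}$, $n\in\mathbb N_0$, be the monic type II multiple orthogonal polynomials and $J$ the Jacobi matrix associated with $(\mu,\vec w,\vec n)$ (see context). Assume that (i) the Jacobi matrix $J$ is nonnegative, i.e. all its entries are $\ge 0$; (ii) the set of zeros $\mathscr Z(B)$ is bounded, i.e. $b(B)<+\infty$, and $b(B)\notin\mathscr Z(B)$. Then, for every $\lambda\ge b(B)$, the diagonal matrix $\sigma_{II}=\operatorname{diag}(\sigma_{II,0},\sigma_{II,1},\dots)$ with $\sigma_{II,n}:=\dfrac{1}{B^{(n)}(\lambda)}$ is such that $$P_{II}:=\frac1\lambda\,\sigma_{II}\,J\,\sigma_{II}^{-1},\qquad P_{II,n,m}=\frac1\lambda\,\frac{B^{(m)}(\lambda)}{B^{(n)}(\lambda)}\,J_{n,m},$$ is a multiple stochastic matrix of type II.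
   Context: General setting. $\Delta\subset\mathbb R$ is an interval, $\mu$ is a finite Borel measure of constant sign on $\Delta$ whose support has infinitely many points, $w_1,\dots,w_p$ are weights on $\Delta$ (real integrable functions, each of constant sign), all the moments $\int_\Delta x^k w_a\,d\mu$ being finite, and $\vec n=(n_1,\dots,n_p)$ is a vector of positive integers, $|\vec n|=n_1+\dots+n_p$. Every $i\in\mathbb N_0$ is written uniquely as $i=q(i)|\vec n|+n_1+\dots+n_{a(i)-1}+r(i)$ with $q(i)\in\mathbb N_0$, $a(i)\in\{1,\dots,p\}$, $0\le r(i)<n_{a(i)}$; put $k(i)=q(i)n_{a(i)}+r(i)$ and $\xi^{(i)}(x)=x^{k(i)}w_{a(i)}(x)$. The pair $(\mu,\vec w)$ is assumed perfect; in particular all leading principal minors of the moment matrix $g_{i,j}=\int_\Delta x^i\xi^{(j)}(x)\,d\mu(x)$ are nonzero. Then: - $B^{(l)}$ is the unique monic polynomial of degree $l$ with $\int_\Delta B^{(l)}\xi^{(j)}\,d\mu=0$ for $0\le j<l$ (type II multiple orthogonal polynomial); - the Jacobi matrix $J=(J_{n,m})_{n,m\in\mathbb N_0}$ is defined by $xB^{(n)}(x)=\sum_m J_{n,m}B^{(m)}(x)$. With $N:=\max_a(|\vec n|-n_a+1)$ one has $J_{n,n+1}=1$ and $J_{n,m}=0$ unless $n-N\le m\le n+1$. $\mathscr Z(B)\subset\mathbb C$ is the union over $n$ of the sets of zeros of $B^{(n)}$, and $b(B):=\sup\{|\zeta|:\zeta\in\mathscr Z(B)\}$. A semi-infinite matrix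 $P$ is stochastic if its entries are nonnegative and each row sums to $1$. A multiple stochastic matrix of type II is a stochastic matrix with $P_{n,m}=0$ unless $n-N\le m\le n+1$. *)

theory Defs
  imports "HOL-Analysis.Analysis" "HOL-Computational_Algebra.Polynomial"
begin

text \<open>
  A Borel measure of constant sign on \<open>\<Delta>\<close> is a pair of a sign \<open>s \<in> {1, -1}\<close> and a
  (nonnegative) measure \<open>M\<close> on \<open>\<Delta>\<close>; it stands for \<open>s M\<close>.
  Weights and the vector of positive integers are indexed by \<open>{1..p}\<close>.
\<close>

definition mu_integral :: "real \<Rightarrow> real measure \<Rightarrow> (real \<Rightarrow> real) \<Rightarrow> real" where
  "mu_integral s M f = s * (LINT x|M. f x)"

definition measure_support :: "real measure \<Rightarrow> real set" where
  "measure_support M =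
     {x \<in> space M. \<forall>U. open U \<and> x \<in> U \<longrightarrow> emeasure M (U \<inter> space M) > 0}"

definition constant_sign_on :: "(real \<Rightarrow> real) \<Rightarrow> real set \<Rightarrow> bool" where
  "constant_sign_on f S \<longleftrightarrow> (\<forall>x\<in>S. 0 \<le> f x) \<or> (\<forall>x\<in>S. f x \<le> 0)"

definition vec_size :: "nat \<Rightarrow> (nat \<Rightarrow> nat) \<Rightarrow> nat" where
  "vec_size p \<nu> = (\<Sum>a=1..p. \<nu> a)"

text \<open>
  All multi-indices \<open>\<nu> \<in> \<nat>\<^sub>0\<^sup>p\<close> are normal: a nonzero polynomial of degree at most
  \<open>|\<nu>|\<close> with the type II orthogonality relations of \<open>\<nu>\<close> has degree exactly \<open>|\<nu>|\<close>.
\<close>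

definition perfect_pair :: "real \<Rightarrow> real measure \<Rightarrow> nat \<Rightarrow> (nat \<Rightarrow> real \<Rightarrow> real) \<Rightarrow> bool" where
  "perfect_pair s M p w \<longleftrightarrow>
     (\<forall>(\<nu> :: nat \<Rightarrow> nat) (Q :: real poly).
        Q \<noteq> 0 \<and> degree Q \<le> vec_size p \<nu> \<and>
        (\<forall>a\<in>{1..p}. \<forall>k<\<nu> a. mu_integral s M (\<lambda>x. poly Q x * (x ^ k * w a x)) = 0)
        \<longrightarrow> degree Q = vec_size p \<nu>)"

definition index_triple :: "nat \<Rightarrow> (nat \<Rightarrow> nat) \<Rightarrow> nat \<Rightarrow> nat \<times> nat \<times> nat" where
  "index_triple p ns i =
     (THE (q, a, r). a \<in> {1..p} \<and> r < ns a \<and>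
        i = q * vec_size p ns + (\<Sum>b=1..<a. ns b) + r)"

definition index_q :: "nat \<Rightarrow> (nat \<Rightarrow> nat) \<Rightarrow> nat \<Rightarrow> nat" where
  "index_q p ns i = fst (index_triple p ns i)"

definition index_a :: "nat \<Rightarrow> (nat \<Rightarrow> nat) \<Rightarrow> nat \<Rightarrow> nat" where
  "index_a p ns i = fst (snd (index_triple p ns i))"

definition index_r :: "nat \<Rightarrow> (nat \<Rightarrow> nat) \<Rightarrow> nat \<Rightarrow> nat" where
  "index_r p ns i = snd (snd (index_triple p ns i))"

definition index_k :: "nat \<Rightarrow> (nat \<Rightarrow> nat) \<Rightarrow> nat \<Rightarrow> nat" where
  "index_k p ns i = index_q p ns i * ns (index_a p ns i) + index_r p ns i"

definition xi :: "nat \<Rightarrow> (nat \<Rightarrow> real \<Rightarrow> real) \<Rightarrow> (nat \<Rightarrow> nat) \<Rightarrow> nat \<Rightarrow> real \<Rightarrow> real" where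
  "xi p w ns i x = x ^ index_k p ns i * w (index_a p ns i) x"

definition mop_typeII ::
  "real \<Rightarrow> real measure \<Rightarrow> nat \<Rightarrow> (nat \<Rightarrow> real \<Rightarrow> real) \<Rightarrow> (nat \<Rightarrow> nat) \<Rightarrow> nat \<Rightarrow> real poly" where
  "mop_typeII s M p w ns l =
     (THE Q. degree Q = l \<and> lead_coeff Q = 1 \<and>
        (\<forall>j<l. mu_integral s M (\<lambda>x. poly Q x * xi p w ns j x) = 0))"

text \<open>Row \<open>n\<close> is the finitely supported coefficient sequence of \<open>x B\<^sub>n\<close> in the basis \<open>B\<close>.\<close>

definition jacobi_matrix :: "(nat \<Rightarrow> real poly) \<Rightarrow> nat \<Rightarrow> nat \<Rightarrow> real" where
  "jacobi_matrix B n =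
     (THE c. finite {m. c m \<noteq> 0} \<and>
        [:0, 1:] * B n = (\<Sum>m | c m \<noteq> 0. smult (c m) (B m)))"

definition bandwidth :: "nat \<Rightarrow> (nat \<Rightarrow> nat) \<Rightarrow> nat" where
  "bandwidth p ns = Max ((\<lambda>a. vec_size p ns - ns a + 1) ` {1..p})"

definition zero_set :: "(nat \<Rightarrow> real poly) \<Rightarrow> complex set" where
  "zero_set B = (\<Union>n. {z. poly (map_poly complex_of_real (B n)) z = 0})"

text \<open>Meaningful only if \<open>zero_set B\<close> is nonempty and bounded.\<close>

definition zero_bound :: "(nat \<Rightarrow> real poly) \<Rightarrow> real" where
  "zero_bound B = (SUP z\<in>zero_set B. cmod z)"

definition diag_mat :: "(nat \<Rightarrow> real) \<Rightarrow> nat \<Rightarrow> nat \<Rightarrow> real" where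
  "diag_mat d n m = (if n = m then d n else 0)"

definition mat_mult :: "(nat \<Rightarrow> nat \<Rightarrow> real) \<Rightarrow> (nat \<Rightarrow> nat \<Rightarrow> real) \<Rightarrow> nat \<Rightarrow> nat \<Rightarrow> real" where
  "mat_mult A C n m = (\<Sum>k. A n k * C k m)"

definition stochastic_matrix :: "(nat \<Rightarrow> nat \<Rightarrow> real) \<Rightarrow> bool" where
  "stochastic_matrix P \<longleftrightarrow> (\<forall>n m. 0 \<le> P n m) \<and> (\<forall>n. (\<lambda>m. P n m) sums 1)"

definition multiple_stochastic_II :: "nat \<Rightarrow> (nat \<Rightarrow> nat \<Rightarrow> real) \<Rightarrow> bool" where
  "multiple_stochastic_II N P \<longleftrightarrow>
     stochastic_matrix P \<and>
     (\<forall>n m. \<not> (int n - int N \<le> int m \<and> m \<le> n + 1) \<longrightarrow> P n m = 0)"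

definition sigma_II :: "(nat \<Rightarrow> real poly) \<Rightarrow> real \<Rightarrow> nat \<Rightarrow> real" where
  "sigma_II B lam n = 1 / poly (B n) lam"

definition P_II :: "(nat \<Rightarrow> real poly) \<Rightarrow> real \<Rightarrow> nat \<Rightarrow> nat \<Rightarrow> real" where
  "P_II B lam n m =
     1 / lam *
     mat_mult (mat_mult (diag_mat (sigma_II B lam)) (jacobi_matrix B))
       (diag_mat (\<lambda>k. inverse (sigma_II B lam k))) n m"

end

theory Submission
  imports Defs
begin

text \<open>
  Positions \<open>i\<close> correspond to pairs \<open>(a, k)\<close> such that \<open>i\<close> increases with \<open>k\<close>, so the first
  \<open>l\<close> functions \<open>\<xi>\<close> form the system of a multi-index of size \<open>l\<close> and normality applies to
  them. The functional of \<open>\<xi>\<^sub>j\<close> therefore does not vanish at \<open>B\<^sub>j\<close>, which yields existence of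
  the \<open>B\<^sub>n\<close> by Gram-Schmidt; and since multiplying \<open>\<xi>\<^sub>j\<close> by \<open>x\<close> moves the position by at most
  \<open>N\<close>, it yields the band structure of \<open>J\<close>. A monic polynomial without zeros in
  \<open>[b(B), \<infinity>)\<close> is positive there, and the rows of \<open>P\<^sub>I\<^sub>I\<close> sum to 1 because
  \<open>\<lambda> B\<^sub>n(\<lambda>) = \<Sum>\<^sub>m J\<^sub>n\<^sub>m B\<^sub>m(\<lambda>)\<close>.
\<close>

section \<open>Graded families of polynomials\<close>

lemma coeff_smult_sum_top:
  fixes B :: "nat \<Rightarrow> 'a::comm_ring_1 poly"
  assumes deg: "\<And>m. degree (B m) = m" and monic: "\<And>m. lead_coeff (B m) = 1"
  shows "coeff (\<Sum>m<Suc l. smult (c m) (B m)) l = c l"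
proof -
  have "coeff (B m) l = 0" if "m < l" for m
    using that deg by (simp add: coeff_eq_0)
  moreover have "coeff (B l) l = 1"
    using deg monic by metis
  ultimately show ?thesis
    by (simp add: coeff_sum)
qed

text \<open>The top coefficient of a vanishing combination isolates its last scalar, so the scalars
  vanish one after another from the top down.\<close>

lemma graded_independent:
  fixes B :: "nat \<Rightarrow> 'a::comm_ring_1 poly"
  assumes deg: "\<And>m. degree (B m) = m" and monic: "\<And>m. lead_coeff (B m) = 1"
    and "(\<Sum>m<l. smult (c m) (B m)) = 0" and "m < l"
  shows "c m = 0"
  using assms(3,4)
proof (induction l)
  case (Suc l)
  have "c l = 0"
    using coeff_smult_sum_top[OF deg monic, where c = c and l = l] unfolding Suc.prems(1) by simp
  with Suc show ?case
    by (cases "m = l") auto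
qed simp

text \<open>Subtracting \<open>coeff Q l\<close> times \<open>B l\<close> cancels the top
  coefficient and leaves the next smaller case. The bound on \<open>Q\<close> is put on coefficients
  rather than on \<open>degree Q\<close>, because for \<open>l = 0\<close> it has to force
  \<open>Q = 0\<close>.\<close>

lemma graded_span:
  fixes B :: "nat \<Rightarrow> 'a::comm_ring_1 poly"
  assumes deg: "\<And>m. degree (B m) = m" and monic: "\<And>m. lead_coeff (B m) = 1"
    and "\<And>i. l \<le> i \<Longrightarrow> coeff Q i = 0"
  obtains c where "Q = (\<Sum>m<l. smult (c m) (B m))"
proof -
  have "\<exists>c. Q = (\<Sum>m<l. smult (c m) (B m))"
    using assms(3)
  proof (induction l arbitrary: Q)
    case 0
    then show ?case by (simp add: poly_eq_iff)
  next
    case (Suc l)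
    have "coeff (Q - smult (coeff Q l) (B l)) i = 0" if "l \<le> i" for i
    proof (cases "i = l")
      case True
      then show ?thesis using deg[of l] monic[of l] by simp
    next
      case False
      with that have "Suc l \<le> i" by simp
      then show ?thesis using Suc.prems deg[of l] by (simp add: coeff_eq_0)
    qed
    from Suc.IH[OF this] obtain c
      where c: "Q - smult (coeff Q l) (B l) = (\<Sum>m<l. smult (c m) (B m))" by blast
    have "Q = (\<Sum>m<Suc l. smult ((c(l := coeff Q l)) m) (B m))"
      using c by (simp add: algebra_simps)
    then show ?case by blast
  qed
  with that show ?thesis by blast
qed

text \<open>Evaluates the definite description in \<open>jacobi_matrix\<close>: linear independence
  of the \<open>B m\<close> makes the finite expansion unique.\<close>

lemma jacobi_matrix_eqI:
  assumes deg: "\<And>m. degree (B m) = m" and monic: "\<And>m. lead_coeff (B m) = 1"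
    and sum: "[:0, 1:] * B n = (\<Sum>m<l. smult (c m) (B m))"
    and supp: "\<And>m. l \<le> m \<Longrightarrow> c m = 0"
  shows "jacobi_matrix B n = c"
  unfolding jacobi_matrix_def
proof (rule the_equality)
  have *: "finite {m. d m \<noteq> 0} \<and> (\<Sum>m | d m \<noteq> 0. smult (d m) (B m)) = (\<Sum>m<k. smult (d m) (B m))"
    if "\<And>m. k \<le> m \<Longrightarrow> d m = 0" for d k
  proof
    have sub: "{m. d m \<noteq> 0} \<subseteq> {..<k}"
      using that by (force simp: not_less[symmetric])
    then show "finite {m. d m \<noteq> 0}"
      using finite_subset by blast
    show "(\<Sum>m | d m \<noteq> 0. smult (d m) (B m)) = (\<Sum>m<k. smult (d m) (B m))"
      using sub by (intro sum.mono_neutral_left) auto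
  qed
  show "finite {m. c m \<noteq> 0} \<and> [:0, 1:] * B n = (\<Sum>m | c m \<noteq> 0. smult (c m) (B m))"
    using *[of l c, OF supp] sum by simp
  fix d assume d: "finite {m. d m \<noteq> 0} \<and> [:0, 1:] * B n = (\<Sum>m | d m \<noteq> 0. smult (d m) (B m))"
  then obtain k0 where k0: "\<And>m. d m \<noteq> 0 \<Longrightarrow> m \<le> k0"
    using finite_nat_set_iff_bounded_le by auto
  \<comment> \<open>A common length beyond both supports, so that the two expansions can be
    subtracted term by term.\<close>
  define k where "k = max l (Suc k0)"
  have dk: "d m = 0" and ck: "c m = 0" if "k \<le> m" for m
    using that k0[of m] supp[of m] by (auto simp: k_def)
  have "(\<Sum>m<k. smult (d m) (B m)) = (\<Sum>m<k. smult (c m) (B m))"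
    using *[of k d, OF dk] *[of k c, OF ck] *[of l c, OF supp] d sum by metis
  then have "(\<Sum>m<k. smult (d m - c m) (B m)) = 0"
    by (simp add: smult_diff_left sum_subtractf)
  from graded_independent[OF deg monic this] have "d m = c m" if "m < k" for m
    using that by simp
  then show "d = c"
    using dk ck by (metis ext not_less)
qed


section \<open>Normal sequences of functionals\<close>

text \<open>Abstracts the functionals that integrate a polynomial against the \<open>xi\<close>
  functions. Normality says that no nonzero polynomial of degree below \<open>l\<close> is
  annihilated by the first \<open>l\<close> functionals, which is the nonvanishing of the leading
  minor of size \<open>l\<close> of the moment matrix.\<close>

locale normal_functionals =
  fixes F :: "nat \<Rightarrow> real poly \<Rightarrow> real"
  assumes F_add: "F j (P + Q) = F j P + F j Q"
    and F_smult: "F j (smult c Q) = c * F j Q"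
    and normal: "\<lbrakk>Q \<noteq> 0; degree Q \<le> l; \<And>j. j < l \<Longrightarrow> F j Q = 0\<rbrakk> \<Longrightarrow> degree Q = l"
begin

lemma F_0: "F j 0 = 0"
  using F_smult[of j 0 0] by simp

lemma F_diff: "F j (P - Q) = F j P - F j Q"
  using F_add[of j P "smult (-1) Q"] F_smult[of j "-1" Q] by simp

lemma F_sum: "F j (\<Sum>i\<in>A. f i) = (\<Sum>i\<in>A. F j (f i))"
  by (induction A rule: infinite_finite_induct) (auto simp: F_0 F_add)

definition is_mop :: "nat \<Rightarrow> real poly \<Rightarrow> bool" where
  "is_mop l Q \<longleftrightarrow> degree Q = l \<and> lead_coeff Q = 1 \<and> (\<forall>j<l. F j Q = 0)"

text \<open>Otherwise \<open>Q\<close> would satisfy \<open>l + 1\<close> orthogonality relations,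
  and normality at \<open>Suc l\<close> would raise its degree to \<open>Suc l\<close>.\<close>

lemma is_mop_diag_nonzero:
  assumes "is_mop l Q"
  shows "F l Q \<noteq> 0"
proof
  assume "F l Q = 0"
  with assms have "F j Q = 0" if "j < Suc l" for j
    using that by (auto simp: is_mop_def less_Suc_eq)
  moreover have "Q \<noteq> 0" "degree Q \<le> Suc l"
    using assms by (auto simp: is_mop_def)
  ultimately have "degree Q = Suc l"
    using normal by blast
  with assms show False
    by (simp add: is_mop_def)
qed

text \<open>The difference is still orthogonal, so normality would give it degree \<open>l\<close>
  if it were nonzero; but the leading terms cancel.\<close>

lemma is_mop_unique:
  assumes "is_mop l P" "is_mop l Q"
  shows "P = Q"
proof (rule ccontr)
  assume "P \<noteq> Q"
  have "degree (P - Q) \<le> l"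
    using assms by (intro degree_diff_le) (auto simp: is_mop_def)
  then have "degree (P - Q) = l"
    using assms \<open>P \<noteq> Q\<close> normal[of "P - Q" l] by (simp add: is_mop_def F_diff)
  moreover have "coeff P l = 1" "coeff Q l = 1"
    using assms unfolding is_mop_def by metis+
  then have "coeff (P - Q) l = 0"
    by simp
  ultimately show False
    using \<open>P \<noteq> Q\<close> by (metis leading_coeff_0_iff right_minus_eq)
qed

lemma is_mop_monom_diff:
  assumes "\<And>i. l \<le> i \<Longrightarrow> coeff R i = 0" "\<And>j. j < l \<Longrightarrow> F j (monom 1 l - R) = 0"
  shows "is_mop l (monom 1 l - R)"
proof -
  have "coeff (monom 1 l - R) l = 1"
    using assms(1) by simp
  moreover have "degree (monom 1 l - R) \<le> l"
    by (rule degree_le) (use assms(1) in auto)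
  ultimately have "degree (monom 1 l - R) = l"
    by (metis le_antisym le_degree zero_neq_one)
  with assms show ?thesis
    unfolding is_mop_def by simp
qed

text \<open>Some \<open>R\<close> of degree below \<open>l\<close> has the same first
  \<open>l\<close> functional values as \<open>Q\<close>. For \<open>Q = monom 1 l\<close> the
  difference is the monic orthogonal polynomial. The induction is over all \<open>Q\<close>, since
  the step needs the hypothesis both for \<open>Q\<close> and for \<open>monom 1 l\<close>.\<close>

lemma interpolation:
  "\<exists>R. (\<forall>i\<ge>l. coeff R i = 0) \<and> (\<forall>j<l. F j (Q - R) = 0)"
proof (induction l arbitrary: Q)
  case 0
  show ?case by (intro exI[of _ 0]) simp
next
  case (Suc l)
  obtain R where R: "\<forall>i\<ge>l. coeff R i = 0" "\<forall>j<l. F j (Q - R) = 0"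
    using Suc.IH by blast
  obtain S where S: "\<forall>i\<ge>l. coeff S i = 0" "\<forall>j<l. F j (monom 1 l - S) = 0"
    using Suc.IH by blast
  define T where "T = monom 1 l - S"
  have T: "is_mop l T"
    unfolding T_def using S by (intro is_mop_monom_diff) auto
  \<comment> \<open>This Gram-Schmidt correction repairs the condition at \<open>l\<close>. It keeps
    those below \<open>l\<close>, where \<open>F j T = 0\<close>, and the divisor is nonzero by
    \<open>is_mop_diag_nonzero\<close>.\<close>
  define c where "c = F l (Q - R) / F l T"
  have "F j (Q - (R + smult c T)) = 0" if "j < Suc l" for j
  proof -
    have "F j (Q - (R + smult c T)) = F j (Q - R) - c * F j T"
      by (simp add: F_diff F_add F_smult)
    also have "\<dots> = 0"
    proof (cases "j = l")
      case True
      then show ?thesis using is_mop_diag_nonzero[OF T] by (simp add: c_def)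
    next
      case False
      then show ?thesis using that R T by (simp add: is_mop_def)
    qed
    finally show ?thesis .
  qed
  moreover have "coeff (R + smult c T) i = 0" if "Suc l \<le> i" for i
    using that R T by (simp add: is_mop_def coeff_eq_0)
  ultimately show ?case by blast
qed

lemma is_mop_exists: "\<exists>Q. is_mop l Q"
  using interpolation[of l "monom 1 l"] is_mop_monom_diff by blast

text \<open>The upper edge of the band comes from the degree of \<open>x * B n\<close>. The lower
  edge comes from moving the factor \<open>x\<close> onto the functional: if
  \<open>m + N < n\<close>, the shifted index is still below \<open>n\<close>, where
  \<open>B n\<close> is annihilated.\<close>

lemma jacobi_matrix_banded:
  assumes B: "\<And>n. is_mop n (B n)"
    and shift: "\<And>j. \<exists>i\<le>j + N. \<forall>Q. F j ([:0, 1:] * Q) = F i Q"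
  shows "[:0, 1:] * B n = (\<Sum>m<Suc (Suc n). smult (jacobi_matrix B n m) (B m))"
    and "Suc n < m \<Longrightarrow> jacobi_matrix B n m = 0"
    and "m + N < n \<Longrightarrow> jacobi_matrix B n m = 0"
proof -
  have deg: "degree (B m) = m" and monic: "lead_coeff (B m) = 1" for m
    using B[of m] unfolding is_mop_def by blast+
  have "coeff ([:0, 1:] * B n) i = 0" if "Suc (Suc n) \<le> i" for i
    using that deg by (auto simp: coeff_pCons coeff_eq_0 split: nat.splits)
  then obtain c0 where c0: "[:0, 1:] * B n = (\<Sum>m<Suc (Suc n). smult (c0 m) (B m))"
    using graded_span[OF deg monic] by blast
  \<comment> \<open>\<open>graded_span\<close> leaves \<open>c0\<close> arbitrary from
    \<open>Suc (Suc n)\<close> on, whereas the row of the Jacobi matrix is 0 there.\<close>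
  define c where "c m = (if m < Suc (Suc n) then c0 m else 0)" for m
  have c: "[:0, 1:] * B n = (\<Sum>m<Suc (Suc n). smult (c m) (B m))"
    unfolding c0 by (intro sum.cong) (auto simp: c_def)
  have J: "jacobi_matrix B n = c"
    by (rule jacobi_matrix_eqI[OF deg monic c]) (auto simp: c_def)
  show "[:0, 1:] * B n = (\<Sum>m<Suc (Suc n). smult (jacobi_matrix B n m) (B m))"
    using c J by simp
  show "Suc n < m \<Longrightarrow> jacobi_matrix B n m = 0"
    unfolding J by (simp add: c_def)
  have "c m = 0" if "m + N < n" for m
    using that
  proof (induction m rule: less_induct)
    case (less m)
    obtain i where "i \<le> m + N" "F m ([:0, 1:] * B n) = F i (B n)"
      using shift by blast
    then have "0 = F m ([:0, 1:] * B n)"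
      using less.prems B by (simp add: is_mop_def)
    also have "\<dots> = (\<Sum>k<Suc (Suc n). c k * F m (B k))"
      unfolding c by (simp only: F_sum F_smult)
    \<comment> \<open>Terms with \<open>k < m\<close> vanish by the induction hypothesis, terms with
      \<open>m < k\<close> by orthogonality of \<open>B k\<close>. Only the nonzero diagonal value
      \<open>F m (B m)\<close> remains as a factor of \<open>c m\<close>.\<close>
    also have "\<dots> = (\<Sum>k\<in>{m}. c k * F m (B k))"
    proof (rule sum.mono_neutral_right)
      show "\<forall>k\<in>{..<Suc (Suc n)} - {m}. c k * F m (B k) = 0"
      proof
        fix k assume "k \<in> {..<Suc (Suc n)} - {m}"
        then consider "k < m" | "m < k" by force
        then show "c k * F m (B k) = 0"
        proof cases
          case 1
          then show ?thesis using less by simp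
        next
          case 2
          then show ?thesis using B[of k] by (simp add: is_mop_def)
        qed
      qed
    qed (use less.prems in auto)
    finally show ?case
      using is_mop_diag_nonzero[OF B] by simp
  qed
  then show "m + N < n \<Longrightarrow> jacobi_matrix B n m = 0"
    unfolding J by simp
qed

end


section \<open>The step-line indexing\<close>

text \<open>The inverse of the map from \<open>i\<close> to the pair of \<open>index_a\<close> and
  \<open>index_k\<close>: the place of \<open>x^k * w a\<close> in the \<open>xi\<close> sequence.
  The quotient and remainder of \<open>k\<close> by \<open>ns a\<close> recover \<open>q\<close> and
  \<open>r\<close>.\<close>

definition position :: "nat \<Rightarrow> (nat \<Rightarrow> nat) \<Rightarrow> nat \<Rightarrow> nat \<Rightarrow> nat" where
  "position p ns a k = k div ns a * vec_size p ns + (\<Sum>b=1..<a. ns b) + k mod ns a"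

lemma partial_sum_mono:
  fixes ns :: "nat \<Rightarrow> nat"
  assumes "a \<le> a'"
  shows "(\<Sum>b=1..<a. ns b) \<le> (\<Sum>b=1..<a'. ns b)"
  using assms by (intro sum_mono2) auto

lemma partial_sum_le_vec_size:
  assumes "a \<in> {1..p}"
  shows "(\<Sum>b=1..<a. ns b) + ns a \<le> vec_size p ns"
proof -
  have "(\<Sum>b=1..<a. ns b) + ns a = (\<Sum>b=1..<Suc a. ns b)"
    using assms by simp
  also have "\<dots> \<le> vec_size p ns"
    unfolding vec_size_def using assms by (intro sum_mono2) auto
  finally show ?thesis .
qed

lemma partial_sum_cases:
  fixes ns :: "nat \<Rightarrow> nat"
  assumes "x < (\<Sum>b=1..p. ns b)"
  obtains a r where "a \<in> {1..p}" "r < ns a" "x = (\<Sum>b=1..<a. ns b) + (r::nat)"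
proof -
  have "\<exists>a\<in>{1..p}. \<exists>r<ns a. x = (\<Sum>b=1..<a. ns b) + r"
    using assms
  proof (induction p)
    case (Suc p)
    show ?case
    proof (cases "x < (\<Sum>b=1..p. ns b)")
      case True
      with Suc.IH obtain a r where "a \<in> {1..p}" "r < ns a" "x = (\<Sum>b=1..<a. ns b) + r"
        by blast
      then show ?thesis
        by (intro bexI[of _ a] exI[of _ r]) auto
    next
      case False
      have "{1..<Suc p} = {1..p}" by auto
      with False Suc.prems show ?thesis
        by (intro bexI[of _ "Suc p"] exI[of _ "x - (\<Sum>b=1..p. ns b)"]) auto
    qed
  qed simp
  with that show thesis by blast
qed

text \<open>Uniqueness is that of a mixed-radix expansion: division by \<open>vec_size p ns\<close>
  determines \<open>q\<close>, and the remainder lies in exactly one of the consecutive blocks of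
  lengths \<open>ns b\<close>.\<close>

lemma index_triple_eq:
  assumes "a \<in> {1..p}" "r < ns a" "i = q * vec_size p ns + (\<Sum>b=1..<a. ns b) + r"
  shows "index_triple p ns i = (q, a, r)"
proof -
  have mod: "i mod vec_size p ns = (\<Sum>b=1..<a. ns b) + r \<and> i div vec_size p ns = q"
    if "a \<in> {1..p}" "r < ns a" "i = q * vec_size p ns + (\<Sum>b=1..<a. ns b) + r" for q a r
  proof -
    have "(\<Sum>b=1..<a. ns b) + r < vec_size p ns"
      using partial_sum_le_vec_size[OF that(1), of ns] that(2) by linarith
    then show ?thesis
      unfolding that(3) by (simp add: add.assoc)
  qed
  have le: "a' \<le> a"
    if "a \<in> {1..p}" "r < ns a" "(\<Sum>b=1..<a. ns b) + r = (\<Sum>b=1..<a'. ns b) + r'" for a a' r r'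
  proof (rule ccontr)
    assume "\<not> a' \<le> a"
    then have "(\<Sum>b=1..<Suc a. ns b) \<le> (\<Sum>b=1..<a'. ns b)"
      by (intro partial_sum_mono) simp
    moreover have "(\<Sum>b=1..<Suc a. ns b) = (\<Sum>b=1..<a. ns b) + ns a"
      using that(1) by simp
    ultimately show False
      using that(2,3) by linarith
  qed
  have unique: "q' = q \<and> a' = a \<and> r' = r"
    if "a' \<in> {1..p}" "r' < ns a'" "i = q' * vec_size p ns + (\<Sum>b=1..<a'. ns b) + r'" for q' a' r'
  proof -
    have eq: "(\<Sum>b=1..<a. ns b) + r = (\<Sum>b=1..<a'. ns b) + r'"
      using mod[OF assms] mod[OF that] by simp
    have "a' = a"
      using le[OF assms(1,2) eq] le[OF that(1,2) eq[symmetric]] by simp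
    then show ?thesis
      using eq mod[OF assms] mod[OF that] by simp
  qed
  show ?thesis
    unfolding index_triple_def
  proof (rule the_equality)
    show "case (q, a, r) of (q, a, r) \<Rightarrow>
        a \<in> {1..p} \<and> r < ns a \<and> i = q * vec_size p ns + (\<Sum>b=1..<a. ns b) + r"
      using assms by simp
  qed (use unique in blast)
qed

lemma index_position:
  assumes "a \<in> {1..p}" "0 < ns a"
  shows "index_a p ns (position p ns a k) = a" "index_k p ns (position p ns a k) = k"
proof -
  have "index_triple p ns (position p ns a k) = (k div ns a, a, k mod ns a)"
    using assms by (intro index_triple_eq) (auto simp: position_def)
  then show "index_a p ns (position p ns a k) = a" "index_k p ns (position p ns a k) = k"
    by (simp_all add: index_k_def index_a_def index_q_def index_r_def)
qed

lemma position_surj: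
  assumes "0 < vec_size p ns"
  obtains a k where "a \<in> {1..p}" "i = position p ns a k"
proof -
  have "i mod vec_size p ns < (\<Sum>b=1..p. ns b)"
    using assms by (simp add: vec_size_def)
  then obtain a r where ar: "a \<in> {1..p}" "r < ns a" "i mod vec_size p ns = (\<Sum>b=1..<a. ns b) + r"
    using partial_sum_cases by blast
  have "i = position p ns a (i div vec_size p ns * ns a + r)"
    using ar div_mult_mod_eq[of i "vec_size p ns"] by (simp add: position_def)
  with ar that show ?thesis by blast
qed

lemma position_Suc:
  assumes "a \<in> {1..p}" "0 < ns a"
  shows "position p ns a k < position p ns a (Suc k)"
    and "position p ns a (Suc k) \<le> position p ns a k + (vec_size p ns - ns a + 1)"
proof -
  have le: "ns a \<le> vec_size p ns"
    using partial_sum_le_vec_size[OF assms(1), of ns] by linarith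
  have "position p ns a (Suc k) = position p ns a k + 1 \<or>
        position p ns a (Suc k) = position p ns a k + (vec_size p ns - ns a + 1)"
  \<comment> \<open>At the last place of a block, the successor is the first place of the same block
    one period later, a jump of \<open>vec_size p ns - (ns a - 1)\<close>. Elsewhere the position
    grows by 1.\<close>
  proof (cases "Suc (k mod ns a) = ns a")
    case True
    then have "Suc k div ns a = Suc (k div ns a)" "Suc k mod ns a = 0"
      by (simp_all add: div_Suc mod_Suc)
    moreover have "k mod ns a = ns a - 1"
      using True by simp
    ultimately show ?thesis
      using le assms(2) by (simp add: position_def)
  next
    case False
    then show ?thesis
      by (simp add: position_def div_Suc mod_Suc)
  qed
  then show "position p ns a k < position p ns a (Suc k)"
    and "position p ns a (Suc k) \<le> position p ns a k + (vec_size p ns - ns a + 1)"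
    by auto
qed

text \<open>Here \<open>\<nu> a\<close> counts the functions with weight \<open>w a\<close> among
  the first \<open>l\<close> of the \<open>xi\<close> sequence. Positions increase with
  \<open>k\<close>, so these are exactly the powers \<open>k < \<nu> a\<close>, and the first
  \<open>l\<close> relations are those of a multi-index.\<close>

lemma initial_positions:
  assumes "1 \<le> p" and pos: "\<And>a. a \<in> {1..p} \<Longrightarrow> 0 < ns a"
  obtains \<nu> where "vec_size p \<nu> = l"
    "\<And>a k. a \<in> {1..p} \<Longrightarrow> k < \<nu> a \<longleftrightarrow> position p ns a k < l"
proof -
  have vec_pos: "0 < vec_size p ns"
    using partial_sum_le_vec_size[of 1 p ns] pos[of 1] assms(1) by simp
  have mono: "strict_mono (position p ns a)" if "a \<in> {1..p}" for a
    using position_Suc(1)[of a p ns, OF that pos[OF that]] by (simp add: strict_mono_Suc_iff)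
  define \<nu> where "\<nu> a = (LEAST k. l \<le> position p ns a k)" for a
  have \<nu>: "k < \<nu> a \<longleftrightarrow> position p ns a k < l" if a: "a \<in> {1..p}" for a k
  proof
    assume "k < \<nu> a"
    then show "position p ns a k < l"
      unfolding \<nu>_def using not_less_Least by (metis not_less)
  next
    assume k: "position p ns a k < l"
    have "l \<le> position p ns a (\<nu> a)"
      \<comment> \<open>The witness \<open>l\<close> works because a strictly increasing sequence of
        naturals satisfies \<open>l \<le> f l\<close>.\<close>
      unfolding \<nu>_def by (rule LeastI[of _ l]) (rule strict_mono_imp_increasing[OF mono[OF a]])
    then have "position p ns a k < position p ns a (\<nu> a)"
      using k by simp
    then show "k < \<nu> a"
      using mono[OF a] by (simp add: strict_mono_less)
  qed
  \<comment> \<open>Comparing cardinalities of the two sides gives the size of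
    \<open>\<nu>\<close>.\<close>
  have "bij_betw (\<lambda>(a, k). position p ns a k) (SIGMA a:{1..p}. {..<\<nu> a}) {..<l}"
  proof (rule bij_betw_byWitness[where f' = "\<lambda>i. (index_a p ns i, index_k p ns i)"])
    show "\<forall>x\<in>SIGMA a:{1..p}. {..<\<nu> a}.
        (index_a p ns (case x of (a, k) \<Rightarrow> position p ns a k),
         index_k p ns (case x of (a, k) \<Rightarrow> position p ns a k)) = x"
      using index_position pos by auto
    have *: "(case (index_a p ns i, index_k p ns i) of (a, k) \<Rightarrow> position p ns a k) = i
        \<and> index_a p ns i \<in> {1..p}" for i
    proof -
      obtain a k where "a \<in> {1..p}" "i = position p ns a k"
        using position_surj[OF vec_pos] by blast
      then show ?thesis using index_position pos by auto
    qed
    then show "\<forall>i\<in>{..<l}. (case (index_a p ns i, index_k p ns i) of (a, k) \<Rightarrow> position p ns a k) = i"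
      by blast
    show "(\<lambda>(a, k). position p ns a k) ` (SIGMA a:{1..p}. {..<\<nu> a}) \<subseteq> {..<l}"
      using \<nu> by auto
    show "(\<lambda>i. (index_a p ns i, index_k p ns i)) ` {..<l} \<subseteq> (SIGMA a:{1..p}. {..<\<nu> a})"
      using * \<nu> by auto
  qed
  from bij_betw_same_card[OF this] have "vec_size p \<nu> = l"
    by (simp add: vec_size_def)
  with \<nu> that show ?thesis by blast
qed


section \<open>The functionals of a perfect pair\<close>

lemma integrable_poly_weight:
  fixes f :: "real \<Rightarrow> real"
  assumes "\<And>k. integrable M (\<lambda>x. x ^ k * f x)"
  shows "integrable M (\<lambda>x. poly Q x * (x ^ k * f x))"
proof -
  have "(\<lambda>x. poly Q x * (x ^ k * f x)) = (\<lambda>x. \<Sum>i\<le>degree Q. coeff Q i * (x ^ (i + k) * f x))"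
    by (simp add: poly_altdef sum_distrib_right power_add mult.assoc)
  moreover have "integrable M (\<lambda>x. \<Sum>i\<le>degree Q. coeff Q i * (x ^ (i + k) * f x))"
    using assms by (intro Bochner_Integration.integrable_sum integrable_mult_right)
  ultimately show ?thesis by simp
qed

definition xi_functional where
  "xi_functional s M p w ns j Q = mu_integral s M (\<lambda>x. poly Q x * xi p w ns j x)"

lemma xi_position:
  assumes "a \<in> {1..p}" "0 < ns a"
  shows "xi p w ns (position p ns a k) x = x ^ k * w a x"
  using index_position[of a p ns k, OF assms] by (simp add: xi_def)

text \<open>Normality at \<open>l\<close> is the perfectness condition for the multi-index supplied
  by \<open>initial_positions\<close>. The finite moments give the integrability behind
  additivity.\<close>

lemma normal_functionals_xi:
  assumes p: "1 \<le> p" and pos: "\<And>a. a \<in> {1..p} \<Longrightarrow> 0 < ns a"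
    and moments: "\<And>a k. a \<in> {1..p} \<Longrightarrow> integrable M (\<lambda>x. x ^ k * w a x)"
    and perfect: "perfect_pair s M p w"
  shows "normal_functionals (xi_functional s M p w ns)"
proof
  have vec_pos: "0 < vec_size p ns"
    using partial_sum_le_vec_size[of 1 p ns] pos[of 1] p by simp
  have int: "integrable M (\<lambda>x. poly Q x * xi p w ns j x)" for Q j
  proof -
    obtain a k where "a \<in> {1..p}" "j = position p ns a k"
      using position_surj[OF vec_pos] by blast
    then show ?thesis
      using integrable_poly_weight[OF moments] pos by (simp add: xi_position)
  qed
  show "xi_functional s M p w ns j (P + Q)
      = xi_functional s M p w ns j P + xi_functional s M p w ns j Q" for j P Q
    using int by (simp add: xi_functional_def mu_integral_def distrib_right distrib_left)
  show "xi_functional s M p w ns j (smult c Q) = c * xi_functional s M p w ns j Q" for j c Q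
    by (simp add: xi_functional_def mu_integral_def mult.assoc)
  fix Q l
  assume Q: "Q \<noteq> 0" "degree Q \<le> l" and orth: "\<And>j. j < l \<Longrightarrow> xi_functional s M p w ns j Q = 0"
  obtain \<nu> where \<nu>: "vec_size p \<nu> = l"
    "\<And>a k. a \<in> {1..p} \<Longrightarrow> k < \<nu> a \<longleftrightarrow> position p ns a k < l"
    using initial_positions[of p ns l] p pos by blast
  have "mu_integral s M (\<lambda>x. poly Q x * (x ^ k * w a x)) = 0" if "a \<in> {1..p}" "k < \<nu> a" for a k
    using orth[of "position p ns a k"] \<nu>(2)[OF that(1)] that pos
    by (simp add: xi_functional_def xi_position)
  then show "degree Q = l"
    using perfect Q \<nu>(1) unfolding perfect_pair_def by blast
qed

text \<open>Multiplying by \<open>x\<close> turns \<open>x^k * w a\<close> into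
  \<open>x^(k+1) * w a\<close>, whose position is at most \<open>vec_size p ns - ns a + 1\<close>
  further on; \<open>bandwidth\<close> is the maximum of these jumps.\<close>

lemma xi_functional_shift:
  assumes p: "1 \<le> p" and pos: "\<And>a. a \<in> {1..p} \<Longrightarrow> 0 < ns a"
  shows "\<exists>i\<le>j + bandwidth p ns. \<forall>Q.
    xi_functional s M p w ns j ([:0, 1:] * Q) = xi_functional s M p w ns i Q"
proof -
  have "0 < vec_size p ns"
    using partial_sum_le_vec_size[of 1 p ns] pos[of 1] p by simp
  then obtain a k where a: "a \<in> {1..p}" and j: "j = position p ns a k"
    using position_surj by blast
  have "vec_size p ns - ns a + 1 \<le> bandwidth p ns"
    unfolding bandwidth_def using a by (intro Max_ge) auto
  then have "position p ns a (Suc k) \<le> j + bandwidth p ns"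
    using position_Suc(2)[of a p ns, OF a pos[OF a], of k] j by linarith
  moreover have "xi_functional s M p w ns j ([:0, 1:] * Q)
      = xi_functional s M p w ns (position p ns a (Suc k)) Q" for Q
    unfolding xi_functional_def j by (simp add: xi_position[of a p ns, OF a pos[OF a]] mult_ac)
  ultimately show ?thesis by blast
qed


section \<open>Positivity and stochasticity\<close>

lemma poly_map_of_real:
  "poly (map_poly complex_of_real q) (complex_of_real x) = complex_of_real (poly q x)"
  by (induction q) (auto simp: map_poly_pCons)

text \<open>A monic polynomial is eventually at least 1, so a negative value at \<open>x\<close>
  would force a zero to the right of \<open>x\<close>.\<close>

lemma monic_pos:
  fixes q :: "real poly"
  assumes monic: "lead_coeff q = 1" and nz: "\<And>x. b \<le> x \<Longrightarrow> poly q x \<noteq> 0" and "b \<le> x"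
  shows "0 < poly q x"
proof (rule ccontr)
  assume "\<not> 0 < poly q x"
  then have neg: "poly q x < 0"
    using nz[OF \<open>b \<le> x\<close>] by simp
  obtain y0 where y0: "\<And>y. y0 \<le> y \<Longrightarrow> lead_coeff q \<le> poly q y"
    using poly_pinfty_gt_lc[of q] monic by auto
  have "0 < poly q (max y0 (x + 1))"
    using y0[of "max y0 (x + 1)"] monic by simp
  then obtain z where "x < z" "poly q z = 0"
    using poly_IVT_pos[of x "max y0 (x + 1)" q] neg by (auto simp: less_max_iff_disj)
  with nz[of z] \<open>b \<le> x\<close> show False by simp
qed

lemma P_II_eq:
  "P_II B lam n m = 1 / lam * (poly (B m) lam / poly (B n) lam) * jacobi_matrix B n m"
proof -
  \<comment> \<open>The series defining each product with a diagonal matrix has at most one nonzero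
    term.\<close>
  have "mat_mult (diag_mat d) A i k = d i * A i k" for d A i k
    unfolding mat_mult_def diag_mat_def by (subst suminf_finite[of "{i}"]) auto
  moreover have "mat_mult A (diag_mat d) i k = A i k * d k" for d A i k
    unfolding mat_mult_def diag_mat_def by (subst suminf_finite[of "{k}"]) auto
  ultimately show ?thesis
    by (simp add: P_II_def sigma_II_def)
qed

lemma zero_bound_props:
  assumes monic: "\<And>n. degree (B n) = n" "\<And>n. lead_coeff (B n) = 1"
    and bdd: "bounded (zero_set B)"
    and notin: "complex_of_real (zero_bound B) \<notin> zero_set B"
  shows "0 < zero_bound B" and "zero_bound B \<le> x \<Longrightarrow> 0 < poly (B n) x"
proof -
  have bdd': "bdd_above (cmod ` zero_set B)"
    using bdd unfolding bounded_iff by (auto intro: bdd_aboveI)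
  have le: "cmod z \<le> zero_bound B" if "z \<in> zero_set B" for z
    unfolding zero_bound_def using that bdd' by (intro cSUP_upper)
  \<comment> \<open>The real zero of the linear polynomial \<open>B 1\<close> makes
    \<open>zero_set B\<close> nonempty, so the supremum is nonnegative.\<close>
  obtain c d where cd: "B 1 = [:c, d:]" "d \<noteq> 0"
    using degree1_coeffs[OF monic(1)] by blast
  with monic(2)[of 1] have "B 1 = [:c, 1:]"
    by simp
  then have "poly (map_poly complex_of_real (B 1)) (complex_of_real (- c)) = 0"
    unfolding poly_map_of_real by simp
  then have root: "complex_of_real (- c) \<in> zero_set B"
    unfolding zero_set_def by blast
  then have "0 \<le> zero_bound B"
    using le norm_ge_zero order_trans by blast
  \<comment> \<open>If the bound were 0, the zero \<open>- c\<close> would itself be 0 and so equal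
    to the bound, which is excluded from \<open>zero_set B\<close>.\<close>
  moreover have "zero_bound B \<noteq> 0"
    using le[OF root] root notin by auto
  ultimately show pos: "0 < zero_bound B" by simp
  have "poly (B n) y \<noteq> 0" if "zero_bound B \<le> y" for y
  proof
    assume "poly (B n) y = 0"
    then have y: "complex_of_real y \<in> zero_set B"
      unfolding zero_set_def by (auto intro!: exI[of _ n] simp: poly_map_of_real)
    \<comment> \<open>Positivity of the bound gives \<open>cmod y = y\<close>, so a real zero at or
      beyond the bound must equal it.\<close>
    from le[OF y] that pos have "y = zero_bound B" by simp
    with y notin show False by simp
  qed
  then show "zero_bound B \<le> x \<Longrightarrow> 0 < poly (B n) x"
    using monic_pos[OF monic(2)] by blast
qed

theorem theorem1:
  fixes \<Delta> :: "real set" and s :: real and M :: "real measure"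
    and p :: nat and w :: "nat \<Rightarrow> real \<Rightarrow> real" and ns :: "nat \<Rightarrow> nat"
    and B :: "nat \<Rightarrow> real poly" and J :: "nat \<Rightarrow> nat \<Rightarrow> real"
  assumes "is_interval \<Delta>"
    and "s = 1 \<or> s = -1"
    and "sets M = sets (restrict_space borel \<Delta>)"
    and "finite_measure M"
    and "infinite (measure_support M)"
    and "1 \<le> p"
    and "\<And>a. a \<in> {1..p} \<Longrightarrow> integrable M (w a)"
    and "\<And>a. a \<in> {1..p} \<Longrightarrow> constant_sign_on (w a) \<Delta>"
    and "\<And>a k. a \<in> {1..p} \<Longrightarrow> integrable M (\<lambda>x. x ^ k * w a x)"
    and "\<And>a. a \<in> {1..p} \<Longrightarrow> 0 < ns a"
    and "perfect_pair s M p w"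
    and B_def: "B = mop_typeII s M p w ns"
    and J_def: "J = jacobi_matrix B"
    and J_nonneg: "\<And>n m. 0 \<le> J n m"
    and zeros_bounded: "bounded (zero_set B)"
    and bound_not_zero: "complex_of_real (zero_bound B) \<notin> zero_set B"
  shows "\<forall>lam\<ge>zero_bound B.
           lam \<noteq> 0 \<and> (\<forall>n. poly (B n) lam \<noteq> 0) \<and>
           (\<forall>n m. P_II B lam n m = 1 / lam * (poly (B m) lam / poly (B n) lam) * J n m) \<and>
           multiple_stochastic_II (bandwidth p ns) (P_II B lam)"
proof (intro allI impI)
  fix lam assume lam: "zero_bound B \<le> lam"
  interpret normal_functionals "xi_functional s M p w ns"
    using assms(6,9-11) by (intro normal_functionals_xi)
  have mop: "is_mop n (B n)" for n
  proof -
    \<comment> \<open>Existence and uniqueness are what make the definite description in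
      \<open>mop_typeII\<close> denote an orthogonal polynomial.\<close>
    have "\<exists>!Q. is_mop n Q"
      using is_mop_exists is_mop_unique by blast
    moreover have "B n = (THE Q. is_mop n Q)"
      unfolding B_def mop_typeII_def is_mop_def xi_functional_def ..
    ultimately show ?thesis
      using theI' by metis
  qed
  have shift: "\<exists>i\<le>j + bandwidth p ns. \<forall>Q.
      xi_functional s M p w ns j ([:0, 1:] * Q) = xi_functional s M p w ns i Q" for j
    using assms(6,10) by (rule xi_functional_shift)
  note banded = jacobi_matrix_banded[of B, OF mop shift, folded J_def]
  have deg: "degree (B n) = n" and monic: "lead_coeff (B n) = 1" for n
    using mop[of n] unfolding is_mop_def by blast+
  note zero_bound_props = zero_bound_props[OF deg monic zeros_bounded bound_not_zero]
  have lam_pos: "0 < lam"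
    using zero_bound_props(1) lam by simp
  have B_pos: "0 < poly (B n) lam" for n
    using zero_bound_props(2)[OF lam] .
  have P: "P_II B lam n m = 1 / lam * (poly (B m) lam / poly (B n) lam) * J n m" for n m
    by (simp add: P_II_eq J_def)
  have P_sums: "(\<lambda>m. P_II B lam n m) sums 1" for n
  proof -
    \<comment> \<open>Evaluating the recurrence at \<open>lam\<close> shows that the values
      \<open>poly (B m) lam\<close> form an eigenvector of \<open>J\<close> for \<open>lam\<close>;
      dividing by the right-hand side normalises the row sum to 1.\<close>
    have row: "(\<Sum>m<Suc (Suc n). J n m * poly (B m) lam) = lam * poly (B n) lam"
      using arg_cong[OF banded(1)[of n], of "\<lambda>q. poly q lam"]
      by (simp add: poly_sum del: sum.lessThan_Suc)
    have "(\<Sum>m<Suc (Suc n). P_II B lam n m)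
        = (\<Sum>m<Suc (Suc n). J n m * poly (B m) lam) / (lam * poly (B n) lam)"
      unfolding sum_divide_distrib by (intro sum.cong) (simp_all add: P field_simps)
    also have "\<dots> = 1"
      unfolding row using lam_pos B_pos[of n] by simp
    finally have "(\<Sum>m<Suc (Suc n). P_II B lam n m) = 1" .
    \<comment> \<open>Entries beyond column \<open>n + 1\<close> vanish with those of
      \<open>J\<close>, so the series is this finite sum.\<close>
    moreover have "(\<lambda>m. P_II B lam n m) sums (\<Sum>m<Suc (Suc n). P_II B lam n m)"
      by (intro sums_finite) (auto simp: P banded(2) not_less Suc_le_eq)
    ultimately show ?thesis by simp
  qed
  have "P_II B lam n m = 0" if "\<not> (int n - int (bandwidth p ns) \<le> int m \<and> m \<le> n + 1)" for n m
  proof -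
    have "m + bandwidth p ns < n \<or> Suc n < m"
      using that by linarith
    then show ?thesis
      using banded(2,3) by (auto simp: P)
  qed
  moreover have "0 \<le> P_II B lam n m" for n m
    unfolding P using lam_pos B_pos J_nonneg by (simp add: less_imp_le)
  ultimately have "multiple_stochastic_II (bandwidth p ns) (P_II B lam)"
    using P_sums by (simp add: multiple_stochastic_II_def stochastic_matrix_def)
  moreover have "lam \<noteq> 0" "\<forall>n. poly (B n) lam \<noteq> 0"
    using lam_pos B_pos by (metis less_irrefl)+
  ultimately show "lam \<noteq> 0 \<and> (\<forall>n. poly (B n) lam \<noteq> 0) \<and>
           (\<forall>n m. P_II B lam n m = 1 / lam * (poly (B m) lam / poly (B n) lam) * J n m) \<and>
           multiple_stochastic_II (bandwidth p ns) (P_II B lam)"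
    using P by blast
qed

end
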